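(* Let $X\in\mathcal{X}^{\alpha}$ for some $\alpha\in(0,1)$ with $\alpha>\frac13$, and let $0<\beta<\alpha\wedge(3\alpha-1)$. Then for every convex function $f:\mathbb{R}\to\mathbb{R}$, with left derivative $f'_-$, the path $t\mapsto f'_-(X_t)$, $t\in[0,T]$, belongs to $W_2^{\beta}$ almost surely.
   Context: Fix $T>0$. Fractional Besov space: for $0<\beta<1$, $W_2^\beta=W_2^\beta([0,T])$ is the space of measurable $h:[0,T]\to\mathbb{R}$ with $$\|h\|_{2,\beta}=\int_0^T\frac{|h(s)|}{s^\beta}\,ds+\int_0^T\int_0^s\frac{|h(u)-h(s)|}{(s-u)^{1+\beta}}\,du\,ds<\infty .$$ Class $\mathcal{X}^\alpha$: for a centered Gaussian process $X=(X_t)_{t\in[0,T]}$ put $R(t,s)=\mathbb{E}[X_tX_s]$, $W(t,s)=\mathbb{E}[(X_t-X_s)^2]$, $V(t)=\mathbb{E}[X_t^2]$ and $w^*(t)=\sup_{0\le s\le T-t}W(t+s,s)$. For $0<\alpha<1$, a centered continuous Gaussian process $X$ on $[0,T]$ belongs to $\mathcal{X}^\alpha$ if (i) $R(s,t)>0$ for all $s,t>0$; (ii) $w^*(t)=Ct^{2\alpha}+o(t^{2\alpha})$ as $t\to0$, for some $C>0$; (iii) there exist $c,\delta>0$ such that $V(s)\ge cs^2$ for $s\le\delta$; (iv) there exists $\delta>0$ such that $\sup_{0<t<2\delta}\sup_{t/2\le s\le t}\frac{R(s,s)}{R(t,s)}<\infty$. *)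

theory Defs
  imports "HOL-Probability.Probability"
begin

text \<open>
  A process on \<open>[0,T]\<close> is rendered as a family indexed by all reals; every notion below looks at
  the indices in \<open>{0..T}\<close> only.
\<close>

text \<open>The degenerate law (point mass at 0) counts as Gaussian; \<^const>\<open>normal_density\<close> does not
  cover it.\<close>

definition centered_gaussian_rv :: "'a measure \<Rightarrow> ('a \<Rightarrow> real) \<Rightarrow> bool" where
  "centered_gaussian_rv M Y \<longleftrightarrow> Y \<in> borel_measurable M \<and>
     ((AE \<omega> in M. Y \<omega> = 0) \<or> (\<exists>\<sigma>>0. distributed M lborel Y (normal_density 0 \<sigma>)))"

definition centered_gaussian_process ::
    "'a measure \<Rightarrow> real \<Rightarrow> (real \<Rightarrow> 'a \<Rightarrow> real) \<Rightarrow> bool" where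
  "centered_gaussian_process M T X \<longleftrightarrow>
     (\<forall>J c. finite J \<and> J \<subseteq> {0..T} \<longrightarrow> centered_gaussian_rv M (\<lambda>\<omega>. \<Sum>t\<in>J. c t * X t \<omega>))"

definition cov_fun :: "'a measure \<Rightarrow> (real \<Rightarrow> 'a \<Rightarrow> real) \<Rightarrow> real \<Rightarrow> real \<Rightarrow> real" where
  "cov_fun M X t s = (\<integral>\<omega>. X t \<omega> * X s \<omega> \<partial>M)"

definition incr_var :: "'a measure \<Rightarrow> (real \<Rightarrow> 'a \<Rightarrow> real) \<Rightarrow> real \<Rightarrow> real \<Rightarrow> real" where
  "incr_var M X t s = (\<integral>\<omega>. (X t \<omega> - X s \<omega>)\<^sup>2 \<partial>M)"

definition var_fun :: "'a measure \<Rightarrow> (real \<Rightarrow> 'a \<Rightarrow> real) \<Rightarrow> real \<Rightarrow> real" where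
  "var_fun M X t = (\<integral>\<omega>. (X t \<omega>)\<^sup>2 \<partial>M)"

text \<open>The real-valued supremum is not a junk value for \<open>0 \<le> t \<le> T\<close>: a centered Gaussian process
  with almost surely continuous paths is continuous in \<open>L\<^sup>2\<close>, so the increment variance is bounded
  on the square \<open>[0,T]\<^sup>2\<close>.\<close>

definition sup_incr_var :: "'a measure \<Rightarrow> real \<Rightarrow> (real \<Rightarrow> 'a \<Rightarrow> real) \<Rightarrow> real \<Rightarrow> real" where
  "sup_incr_var M T X t = (SUP s\<in>{0..T - t}. incr_var M X (t + s) s)"

text \<open>In the last two conditions the times are additionally restricted to \<open>[0,T]\<close>, where the process
  lives; since \<open>\<delta>\<close> may always be decreased, this costs no generality. The last supremum is taken in
  the extended reals, so that its finiteness is a genuine condition.\<close>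

definition class_X :: "'a measure \<Rightarrow> real \<Rightarrow> real \<Rightarrow> (real \<Rightarrow> 'a \<Rightarrow> real) \<Rightarrow> bool" where
  "class_X M T \<alpha> X \<longleftrightarrow>
     centered_gaussian_process M T X \<and>
     (AE \<omega> in M. continuous_on {0..T} (\<lambda>t. X t \<omega>)) \<and>
     (\<forall>s\<in>{0<..T}. \<forall>t\<in>{0<..T}. cov_fun M X s t > 0) \<and>
     (\<exists>C>0. (\<lambda>t. sup_incr_var M T X t - C * t powr (2 * \<alpha>))
               \<in> o[at_right 0](\<lambda>t. t powr (2 * \<alpha>))) \<and>
     (\<exists>c>0. \<exists>\<delta>>0. \<forall>s\<in>{0..T}. s \<le> \<delta> \<longrightarrow> var_fun M X s \<ge> c * s\<^sup>2) \<and>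
     (\<exists>\<delta>>0. (SUP t\<in>{0<..<2 * \<delta>} \<inter> {0..T}. SUP s\<in>{t / 2..t}.
               ereal (cov_fun M X s s / cov_fun M X t s)) < \<infinity>)"

text \<open>The diagonal \<open>u = s\<close> and the point \<open>s = 0\<close>, where the divisions below have the value 0, are
  null sets.\<close>

definition besov_norm :: "real \<Rightarrow> real \<Rightarrow> (real \<Rightarrow> real) \<Rightarrow> ennreal" where
  "besov_norm T \<beta> h =
     (\<integral>\<^sup>+s\<in>{0..T}. ennreal (\<bar>h s\<bar> / s powr \<beta>) \<partial>lborel) +
     (\<integral>\<^sup>+s\<in>{0..T}. (\<integral>\<^sup>+u\<in>{0..s}. ennreal (\<bar>h u - h s\<bar> / (s - u) powr (1 + \<beta>)) \<partial>lborel) \<partial>lborel)"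

definition besov_space :: "real \<Rightarrow> real \<Rightarrow> (real \<Rightarrow> real) set" where
  "besov_space T \<beta> =
     {h. h \<in> borel_measurable (restrict_space borel {0..T}) \<and> besov_norm T \<beta> h < \<infinity>}"

definition left_deriv :: "(real \<Rightarrow> real) \<Rightarrow> real \<Rightarrow> real" where
  "left_deriv f x = (THE D. (f has_real_derivative D) (at_left x))"

end

theory Submission
  imports Defs
begin

text \<open>
  The left derivative \<open>g\<close> of a convex function is nondecreasing, so the claim is one about nondecreasing \<open>g\<close>.
  Almost every path of \<open>X\<close> is bounded, so \<open>g\<close> may be replaced by a truncation that is constant
  outside \<open>[-n,n]\<close>, one \<open>n\<close> at a time; for a bounded \<open>g\<close> it suffices to show that the \<^emph>\<open>expectation\<close> of the
  double integral in the Besov norm is finite.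

  For a bounded nondecreasing \<open>g\<close>, the difference \<open>\<bar>g(X\<^sub>u) - g(X\<^sub>s)\<bar>\<close> is the length of the set of heights \<open>v\<close>
  lying between the two values. Each height \<open>v\<close> corresponds to a level \<open>c\<close> at which \<open>g\<close> passes \<open>v\<close>, and \<open>v\<close>
  counts only if \<open>c\<close> lies between \<open>X\<^sub>u\<close> and \<open>X\<^sub>s\<close>, hence only if \<open>\<bar>X\<^sub>s - c\<bar> \<le> \<bar>X\<^sub>s - X\<^sub>u\<bar>\<close>. By Fubini,
  \<open>E\<bar>g(X\<^sub>u) - g(X\<^sub>s)\<bar>\<close> is at most the oscillation of \<open>g\<close> times the largest probability of this event
  (\<open>nn_integral_mono_diff_le\<close>).

  That probability is estimated from the one-dimensional laws of \<open>X\<^sub>s\<close> and \<open>X\<^sub>s - X\<^sub>u\<close>. For any threshold \<open>h\<close>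
  the event forces either \<open>\<bar>X\<^sub>s - c\<bar> \<le> h\<close>, which has probability at most \<open>h / sqrt (V(s))\<close> since the Gaussian
  density is bounded, or \<open>\<bar>X\<^sub>s - X\<^sub>u\<bar> \<ge> h\<close>, which by Markov's inequality for a high even moment has
  probability at most a constant times \<open>W(s,u)\<^sup>k / h\<^sup>2\<^sup>k\<close>. Condition (ii) gives \<open>W(s,u) \<le> K (s-u)\<^sup>2\<^sup>\<alpha>\<close> and,
  by compactness, positivity (i) extends the bound (iii) to \<open>V(s) \<ge> a s\<^sup>2\<close> on the whole of \<open>[0,T]\<close>. Choosing \<open>h = (s-u)\<^sup>\<gamma>\<close> with
  \<open>\<beta> < \<gamma> < \<alpha>\<close> and \<open>k\<close> large, both terms are at most a constant times \<open>(s-u)\<^sup>\<gamma> / s\<close>: the gap between \<open>\<beta>\<close>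
  and \<open>\<alpha>\<close> pays for the crude choice of \<open>h\<close> (\<open>class_X_straddle\<close>). The expected double integral is then
  at most a constant times \<open>\<integral>\<integral> (s-u)\<^sup>\<gamma>\<^sup>-\<^sup>\<beta>\<^sup>-\<^sup>1 / s du ds\<close>, which is a multiple of the convergent integral
  \<open>\<integral> s\<^sup>\<gamma>\<^sup>-\<^sup>\<beta>\<^sup>-\<^sup>1 ds\<close> (\<open>besov_kernel_finite\<close>).

  Two preparations are needed. A jointly measurable version of the process with all paths continuous
  makes Fubini's theorem applicable (\<open>continuous_modification\<close>,
  \<open>measurable_split_continuous_process\<close>). And the real-valued supremum in condition (ii) bounds individual
  increments only once the variances are known to be bounded on \<open>[0,T]\<close> (\<open>var_fun_bounded\<close>).
\<close>

section \<open>The left derivative of a convex function\<close>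

lemma convex_chord_slope_mono:
  fixes f :: "real \<Rightarrow> real"
  assumes "convex_on UNIV f" "a \<le> b" "b < x"
  shows "(f a - f x) / (a - x) \<le> (f b - f x) / (b - x)"
proof (cases "a = b")
  case False
  have "(f a - f x) / (a - x) \<le> (f b - f x) / (b - x)"
    by (rule convex_on_slope_le(2)[OF assms(1)]) (use assms False in auto)
  then show ?thesis .
qed simp

text \<open>
  The chord slopes to a fixed point \<open>x\<close> increase as the other endpoint approaches \<open>x\<close> from the left, and
  any chord from \<open>x\<close> to the right bounds them, so their one-sided limit exists and is their supremum. In
  particular the description in \<^const>\<open>left_deriv\<close> denotes.
\<close>

lemma convex_on_left_deriv:
  fixes f :: "real \<Rightarrow> real"
  assumes f: "convex_on UNIV f"
  shows "left_deriv f x = (SUP t\<in>{..<x}. (f t - f x) / (t - x))"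
    and "bdd_above ((\<lambda>t. (f t - f x) / (t - x)) ` {..<x})"
proof -
  let ?q = "\<lambda>t. (f t - f x) / (t - x)"
  have bd: "?q b \<le> (f x - f (x + 1)) / (x - (x + 1))" if "b < x" for b
  proof -
    have "?q b \<le> (f b - f (x+1)) / (b - (x+1))"
      by (rule convex_on_slope_le(1)[OF f]) (use that in auto)
    also have "\<dots> \<le> (f x - f (x + 1)) / (x - (x + 1))"
      by (rule convex_chord_slope_mono[OF f]) (use that in auto)
    finally show ?thesis .
  qed
  show "bdd_above (?q ` {..<x})"
    using bd by (auto intro!: bdd_aboveI2)
  have "(?q \<longlongrightarrow> Sup (?q ` ({..<x} \<inter> UNIV))) (at x within ({..<x} \<inter> UNIV))"
    by (rule Lim_left_bound) (use bd convex_chord_slope_mono[OF f] in auto)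
  then have D: "(f has_real_derivative Sup (?q ` {..<x})) (at_left x)"
    by (simp add: has_field_derivative_iff)
  show "left_deriv f x = Sup (?q ` {..<x})"
    unfolding left_deriv_def
  proof (rule the_equality, rule D)
    fix E assume "(f has_real_derivative E) (at_left x)"
    with D show "E = Sup (?q ` {..<x})"
      using tendsto_unique[of "at_left x"] by (auto simp: has_field_derivative_iff)
  qed
qed

lemma mono_left_deriv:
  fixes f :: "real \<Rightarrow> real"
  assumes f: "convex_on UNIV f"
  shows "mono (left_deriv f)"
proof (rule monoI)
  fix x y :: real assume "x \<le> y"
  show "left_deriv f x \<le> left_deriv f y"
  proof (cases "x = y")
    case False
    with \<open>x \<le> y\<close> have "x < y" by simp
    have "left_deriv f x \<le> (f x - f y) / (x - y)"
      unfolding convex_on_left_deriv(1)[OF f]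
    proof (rule cSUP_least)
      fix t assume "t \<in> {..<x}"
      then have "(f t - f x) / (t - x) \<le> (f t - f y) / (t - y)"
        by (intro convex_on_slope_le(1)[OF f]) (use \<open>x < y\<close> in auto)
      also have "\<dots> \<le> (f x - f y) / (x - y)"
        by (rule convex_chord_slope_mono[OF f]) (use \<open>x < y\<close> \<open>t \<in> {..<x}\<close> in auto)
      finally show "(f t - f x) / (t - x) \<le> (f x - f y) / (x - y)" .
    qed (auto intro: lt_ex)
    also have "\<dots> \<le> left_deriv f y"
      unfolding convex_on_left_deriv(1)[OF f]
      by (rule cSUP_upper[OF _ convex_on_left_deriv(2)[OF f]]) (use \<open>x < y\<close> in auto)
    finally show ?thesis .
  qed simp
qed

section \<open>Increments of a monotone function of a random variable\<close>

text \<open>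
  The layers are cut off at \<open>lo\<close> and \<open>hi\<close> so that a bound uniform in the height can be integrated
  over an interval of finite length. For \<open>b < a\<close> both sides vanish.
\<close>

lemma nn_integral_layers:
  fixes a b lo hi :: real
  assumes "lo \<le> a" "b \<le> hi"
  shows "(\<integral>\<^sup>+v. indicator {lo..hi} v * indicator {a<..b} v \<partial>lborel) = ennreal (b - a)"
proof -
  have "(\<lambda>v. indicator {lo..hi} v * indicator {a<..b} v :: ennreal) = indicator {a<..b}"
    using assms by (auto simp: indicator_def)
  then show ?thesis
    by (cases "a \<le> b") (auto simp: ennreal_neg)
qed

text \<open>
  Layer cake: a height \<open>v\<close> between \<open>g(X)\<close> and \<open>g(Y)\<close> forces the level at which \<open>g\<close> reaches \<open>v\<close> to lie
  between \<open>X\<close> and \<open>Y\<close>, and so within distance \<open>\<bar>X - Y\<bar>\<close> of \<open>X\<close>. This takes the place of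
  integration against the Stieltjes measure of \<open>g\<close>.
\<close>

lemma (in prob_space) nn_integral_mono_diff_le:
  fixes X Y :: "'a \<Rightarrow> real" and g :: "real \<Rightarrow> real"
  assumes X[measurable]: "X \<in> borel_measurable M" and Y[measurable]: "Y \<in> borel_measurable M"
    and g: "mono g" and bnd: "\<And>x. lo \<le> g x" "\<And>x. g x \<le> hi"
    and p: "0 \<le> p" and cross: "\<And>c. prob {\<omega>\<in>space M. \<bar>X \<omega> - c\<bar> \<le> \<bar>X \<omega> - Y \<omega>\<bar>} \<le> p"
  shows "(\<integral>\<^sup>+\<omega>. ennreal \<bar>g (Y \<omega>) - g (X \<omega>)\<bar> \<partial>M) \<le> ennreal ((hi - lo) * p)"
proof -
  interpret P: pair_sigma_finite M "lborel :: real measure" ..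
  have [measurable]: "g \<in> borel_measurable borel" by (rule borel_measurable_mono[OF g])
  let ?a = "\<lambda>\<omega>. min (g (X \<omega>)) (g (Y \<omega>))" and ?b = "\<lambda>\<omega>. max (g (X \<omega>)) (g (Y \<omega>))"
  have lohi: "lo \<le> hi" using bnd[of 0] by linarith
  let ?F = "\<lambda>\<omega> v. indicator {lo..hi} v * (if ?a \<omega> < v \<and> v \<le> ?b \<omega> then 1 else 0 :: ennreal)"
  have "(\<integral>\<^sup>+\<omega>. ennreal \<bar>g (Y \<omega>) - g (X \<omega>)\<bar> \<partial>M) = (\<integral>\<^sup>+\<omega>. (\<integral>\<^sup>+v. ?F \<omega> v \<partial>lborel) \<partial>M)"
  proof (rule nn_integral_cong)
    fix \<omega>
    have "ennreal \<bar>g (Y \<omega>) - g (X \<omega>)\<bar> = ennreal (?b \<omega> - ?a \<omega>)"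
      by (rule arg_cong[where f=ennreal]) auto
    also have "\<dots> = (\<integral>\<^sup>+v. indicator {lo..hi} v * indicator {?a \<omega><..?b \<omega>} v \<partial>lborel)"
      by (rule nn_integral_layers[symmetric]) (use bnd in \<open>auto simp: min_def max_def\<close>)
    also have "\<dots> = (\<integral>\<^sup>+v. ?F \<omega> v \<partial>lborel)"
      by (intro nn_integral_cong) (auto simp: indicator_def)
    finally show "ennreal \<bar>g (Y \<omega>) - g (X \<omega>)\<bar> = (\<integral>\<^sup>+v. ?F \<omega> v \<partial>lborel)" .
  qed
  also have "\<dots> = (\<integral>\<^sup>+v. (\<integral>\<^sup>+\<omega>. ?F \<omega> v \<partial>M) \<partial>lborel)"
    by (rule P.Fubini'[symmetric]) measurable
  also have "\<dots> \<le> (\<integral>\<^sup>+v. indicator {lo..hi} v * ennreal p \<partial>lborel)"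
  proof (rule nn_integral_mono)
    fix v :: real
    have "(\<integral>\<^sup>+\<omega>. (if ?a \<omega> < v \<and> v \<le> ?b \<omega> then 1 else 0) \<partial>M) \<le> ennreal p"
    proof -
      \<comment> \<open>The level at which \<open>g\<close> reaches the height \<open>v\<close>. If \<open>g\<close> never or always does, the infimum is
        arbitrary, but then no pair of values of \<open>g\<close> straddles \<open>v\<close>.\<close>
      define c where "c = Inf {z. v \<le> g z}"
      have sep: "\<bar>X \<omega> - c\<bar> \<le> \<bar>X \<omega> - Y \<omega>\<bar>" if "?a \<omega> < v" "v \<le> ?b \<omega>" for \<omega>
      proof -
        have btw: "x \<le> c \<and> c \<le> y" if "g x < v" "v \<le> g y" for x y
        proof
          have low: "x \<le> z" if "v \<le> g z" for z
            using \<open>g x < v\<close> that monoD[OF g, of z x] by (cases "z \<le> x") auto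
          show "x \<le> c" unfolding c_def
            by (rule cInf_greatest) (use low that in auto)
          show "c \<le> y" unfolding c_def
            by (rule cInf_lower) (use low that in \<open>auto intro: bdd_belowI[of _ x]\<close>)
        qed
        show ?thesis
          using that btw[of "X \<omega>" "Y \<omega>"] btw[of "Y \<omega>" "X \<omega>"]
          by (auto simp: min_def max_def split: if_splits)
      qed
      have "(\<integral>\<^sup>+\<omega>. (if ?a \<omega> < v \<and> v \<le> ?b \<omega> then 1 else 0) \<partial>M)
          \<le> (\<integral>\<^sup>+\<omega>. indicator {\<omega>\<in>space M. \<bar>X \<omega> - c\<bar> \<le> \<bar>X \<omega> - Y \<omega>\<bar>} \<omega> \<partial>M)"
        by (intro nn_integral_mono) (use sep in \<open>auto simp: indicator_def\<close>)
      also have "\<dots> = emeasure M {\<omega>\<in>space M. \<bar>X \<omega> - c\<bar> \<le> \<bar>X \<omega> - Y \<omega>\<bar>}"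
        by (rule nn_integral_indicator) measurable
      also have "\<dots> \<le> ennreal p"
        using cross[of c] by (simp add: emeasure_eq_measure ennreal_leI)
      finally show ?thesis .
    qed
    then show "(\<integral>\<^sup>+\<omega>. ?F \<omega> v \<partial>M) \<le> indicator {lo..hi} v * ennreal p"
      by (subst nn_integral_cmult) (auto intro!: mult_left_mono)
  qed
  also have "\<dots> = ennreal (hi - lo) * ennreal p"
    using lohi by (subst nn_integral_multc) auto
  also have "\<dots> = ennreal ((hi - lo) * p)"
    using lohi p by (simp add: ennreal_mult)
  finally show ?thesis .
qed

section \<open>Versions of processes with continuous paths\<close>

text \<open>
  The process sampled at the grid point below \<open>t\<close> is measurable in both variables, because the grid is
  countable; continuity of the paths makes these samples converge.
\<close>

lemma measurable_split_continuous_process: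
  fixes Z :: "real \<Rightarrow> 'a \<Rightarrow> real"
  assumes meas: "\<And>t. Z t \<in> borel_measurable M"
    and cont: "\<And>\<omega>. \<omega> \<in> space M \<Longrightarrow> continuous_on UNIV (\<lambda>t. Z t \<omega>)"
  shows "(\<lambda>(t, \<omega>). Z t \<omega>) \<in> borel_measurable (borel \<Otimes>\<^sub>M M)"
proof (rule borel_measurable_LIMSEQ_real)
  let ?r = "\<lambda>n t. of_int \<lfloor>real (Suc n) * t\<rfloor> / real (Suc n)"
  show "(\<lambda>p. Z (?r n (fst p)) (snd p)) \<in> borel_measurable (borel \<Otimes>\<^sub>M M)" for n
  proof -
    note [measurable] = meas
    have "(\<lambda>p. (\<lambda>k p. Z (of_int k / real (Suc n)) (snd p)) (\<lfloor>real (Suc n) * fst p\<rfloor>) p)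
        \<in> borel_measurable (borel \<Otimes>\<^sub>M M)"
      by (rule measurable_compose_countable) measurable
    then show ?thesis by simp
  qed
  fix p :: "real \<times> 'a" assume p: "p \<in> space (borel \<Otimes>\<^sub>M M)"
  obtain t \<omega> where [simp]: "p = (t, \<omega>)" by (cases p)
  have "(\<lambda>n. ?r n t) \<longlonglongrightarrow> t"
  proof (rule LIMSEQ_I)
    fix e :: real assume "0 < e"
    obtain N where N: "inverse (real (Suc N)) < e" using reals_Archimedean[OF \<open>0<e\<close>] by blast
    have "norm (?r n t - t) < e" if "n \<ge> N" for n
    proof -
      have "\<bar>?r n t - t\<bar> = \<bar>of_int \<lfloor>real (Suc n) * t\<rfloor> - real (Suc n) * t\<bar> / real (Suc n)"
        by (simp add: field_simps abs_divide[symmetric] del: of_nat_Suc abs_divide)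
      also have "\<dots> \<le> 1 / real (Suc n)"
        by (intro divide_right_mono) linarith+
      also have "\<dots> \<le> inverse (real (Suc N))"
        using that by (simp add: field_simps)
      finally show ?thesis using N by simp
    qed
    then show "\<exists>no. \<forall>n\<ge>no. norm (?r n t - t) < e" by blast
  qed
  moreover have "isCont (\<lambda>t. Z t \<omega>) t"
    using cont[of \<omega>] p by (auto simp: continuous_on_eq_continuous_at space_pair_measure)
  ultimately show "(\<lambda>n. Z (?r n (fst p)) (snd p)) \<longlonglongrightarrow> (case p of (t, \<omega>) \<Rightarrow> Z t \<omega>)"
    using isCont_tendsto_compose[of t "\<lambda>t. Z t \<omega>"] by simp
qed

text \<open>
  The paths are set to zero on a measurable null set that contains the exceptional event, which itself
  need not be measurable, and are extended by constants outside \<open>[0,T]\<close>.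
\<close>

lemma continuous_modification:
  fixes X :: "real \<Rightarrow> 'a \<Rightarrow> real"
  assumes T: "0 \<le> T" and meas: "\<And>t. t \<in> {0..T} \<Longrightarrow> X t \<in> borel_measurable M"
    and cont: "AE \<omega> in M. continuous_on {0..T} (\<lambda>t. X t \<omega>)"
  shows "\<exists>Z :: real \<Rightarrow> 'a \<Rightarrow> real. (\<forall>t. Z t \<in> borel_measurable M)
    \<and> (\<forall>\<omega>. continuous_on UNIV (\<lambda>t. Z t \<omega>) \<and> bounded (range (\<lambda>t. Z t \<omega>)))
    \<and> (AE \<omega> in M. \<forall>t\<in>{0..T}. Z t \<omega> = X t \<omega>)"
proof -
  from cont obtain N where "{\<omega>\<in>space M. \<not> continuous_on {0..T} (\<lambda>t. X t \<omega>)} \<subseteq> N"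
    "emeasure M N = 0" "N \<in> sets M"
    by (rule AE_E)
  then have N: "N \<in> null_sets M"
    "{\<omega>\<in>space M. \<not> continuous_on {0..T} (\<lambda>t. X t \<omega>)} \<subseteq> N"
    by auto
  define Z where "Z t \<omega> = (if \<omega> \<in> space M - N then X (max 0 (min T t)) \<omega> else 0)" for t \<omega>
  have cl: "max 0 (min T t) \<in> {0..T}" for t using T by auto
  have cX: "continuous_on {0..T} (\<lambda>t. X t \<omega>)" if "\<omega> \<in> space M - N" for \<omega>
    using N(2) that by blast
  show ?thesis
  proof (intro exI[of _ Z] conjI allI)
    show "Z t \<in> borel_measurable M" for t
    proof -
      have [measurable]: "X (max 0 (min T t)) \<in> borel_measurable M" by (rule meas[OF cl])
      have [measurable]: "N \<in> sets M" using N(1) by auto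
      show ?thesis unfolding Z_def by measurable
    qed
    show "continuous_on UNIV (\<lambda>t. Z t \<omega>)" for \<omega>
    proof (cases "\<omega> \<in> space M - N")
      case True
      have "continuous_on UNIV (\<lambda>t. X (max 0 (min T t)) \<omega>)"
        by (rule continuous_on_compose2[OF cX[OF True], where f="\<lambda>t. max 0 (min T t)"])
           (use cl in \<open>auto intro!: continuous_intros\<close>)
      then show ?thesis using True by (simp add: Z_def)
    qed (auto simp: Z_def)
    show "AE \<omega> in M. \<forall>t\<in>{0..T}. Z t \<omega> = X t \<omega>"
      using AE_not_in[OF N(1)] AE_space by eventually_elim (auto simp: Z_def)
    show "bounded (range (\<lambda>t. Z t \<omega>))" for \<omega>
    proof (cases "\<omega> \<in> space M - N")
      case True
      have "bounded ((\<lambda>t. X t \<omega>) ` {0..T})"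
        by (intro compact_imp_bounded compact_continuous_image cX True) simp
      moreover have "range (\<lambda>t. Z t \<omega>) \<subseteq> (\<lambda>t. X t \<omega>) ` {0..T}"
        using True cl by (auto simp: Z_def)
      ultimately show ?thesis by (rule bounded_subset)
    qed (auto simp: Z_def)
  qed
qed

section \<open>One-dimensional Gaussian estimates\<close>

context prob_space
begin

lemma centered_gaussian_even_moment:
  assumes Y: "centered_gaussian_rv M Y"
  shows "integrable M (\<lambda>\<omega>. Y \<omega> ^ (2 * k))"
    and "expectation (\<lambda>\<omega>. Y \<omega> ^ (2 * k))
           = fact (2 * k) / (2 ^ k * fact k) * expectation (\<lambda>\<omega>. (Y \<omega>)\<^sup>2) ^ k"
proof -
  have [measurable]: "Y \<in> borel_measurable M" using Y by (simp add: centered_gaussian_rv_def)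
  from Y consider (zero) "AE \<omega> in M. Y \<omega> = 0"
    | (normal) \<sigma> where "0 < \<sigma>" "distributed M lborel Y (normal_density 0 \<sigma>)"
    by (auto simp: centered_gaussian_rv_def)
  then have "integrable M (\<lambda>\<omega>. Y \<omega> ^ (2 * k)) \<and>
    expectation (\<lambda>\<omega>. Y \<omega> ^ (2 * k))
      = fact (2 * k) / (2 ^ k * fact k) * expectation (\<lambda>\<omega>. (Y \<omega>)\<^sup>2) ^ k"
  proof cases
    case zero
    have pow: "AE \<omega> in M. Y \<omega> ^ (2 * n) = 0 ^ (2 * n)" for n
      using zero by eventually_elim simp
    have mom: "expectation (\<lambda>\<omega>. Y \<omega> ^ (2 * n)) = 0 ^ (2 * n)" for n
      using integral_cong_AE[OF _ _ pow[of n]] by (simp add: prob_space)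
    from mom[of 1] have "expectation (\<lambda>\<omega>. (Y \<omega>)\<^sup>2) = 0" by simp
    moreover have "integrable M (\<lambda>\<omega>. Y \<omega> ^ (2 * k))"
      using integrable_cong_AE[OF _ _ pow[of k]] by simp
    ultimately show ?thesis unfolding mom by (cases k) simp_all
  next
    case normal
    have dens: "0 \<le> normal_density 0 \<sigma> x" for x :: real
      by (simp add: normal_density_nonneg)
    have mom: "expectation (\<lambda>\<omega>. Y \<omega> ^ (2 * n)) = fact (2 * n) / ((2 / \<sigma>\<^sup>2) ^ n * fact n)" for n
      using distributed_integral[OF normal(2), of "\<lambda>x. x ^ (2 * n)"] dens
        integral_normal_moment_even[OF normal(1), of 0 n] by simp
    have "integrable M (\<lambda>\<omega>. Y \<omega> ^ (2 * k))"
      using distributed_integrable[OF normal(2), of "\<lambda>x. x ^ (2 * k)"] dens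
        integrable.intros[OF normal_moment_even[OF normal(1), of 0 k]] by simp
    moreover have "expectation (\<lambda>\<omega>. (Y \<omega>)\<^sup>2) = \<sigma>\<^sup>2"
      using mom[of 1] by (simp add: fact_numeral)
    ultimately show ?thesis
      using mom[of k] normal(1) by (simp add: power_divide)
  qed
  then show "integrable M (\<lambda>\<omega>. Y \<omega> ^ (2 * k))"
    and "expectation (\<lambda>\<omega>. Y \<omega> ^ (2 * k))
           = fact (2 * k) / (2 ^ k * fact k) * expectation (\<lambda>\<omega>. (Y \<omega>)\<^sup>2) ^ k"
    by auto
qed

text \<open>
  The exponent \<open>k\<close> is left free: a high moment turns a small surplus in the Hoelder exponent into any
  desired power.
\<close>

lemma centered_gaussian_tail:
  assumes Y: "centered_gaussian_rv M Y" and h: "0 < h"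
  shows "prob {\<omega>\<in>space M. h \<le> \<bar>Y \<omega>\<bar>}
           \<le> fact (2 * k) / (2 ^ k * fact k) * expectation (\<lambda>\<omega>. (Y \<omega>)\<^sup>2) ^ k / h ^ (2 * k)"
proof -
  have [measurable]: "Y \<in> borel_measurable M" using Y by (simp add: centered_gaussian_rv_def)
  have "prob {\<omega>\<in>space M. h \<le> \<bar>Y \<omega>\<bar>} \<le> prob {\<omega>\<in>space M. h ^ (2 * k) \<le> Y \<omega> ^ (2 * k)}"
  proof (rule finite_measure_mono)
    show "{\<omega>\<in>space M. h \<le> \<bar>Y \<omega>\<bar>} \<subseteq> {\<omega>\<in>space M. h ^ (2 * k) \<le> Y \<omega> ^ (2 * k)}"
    proof safe
      fix \<omega> assume "h \<le> \<bar>Y \<omega>\<bar>"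
      then have "h ^ (2 * k) \<le> \<bar>Y \<omega>\<bar> ^ (2 * k)" using h by (intro power_mono) auto
      then show "h ^ (2 * k) \<le> Y \<omega> ^ (2 * k)" by (simp add: power_even_abs)
    qed
  qed measurable
  also have "\<dots> \<le> expectation (\<lambda>\<omega>. Y \<omega> ^ (2 * k)) / h ^ (2 * k)"
    by (rule integral_Markov_inequality_measure[where A="{}"])
       (use centered_gaussian_even_moment(1)[OF Y] h in auto)
  finally show ?thesis by (simp only: centered_gaussian_even_moment(2)[OF Y])
qed

text \<open>
  The density is at most \<open>1 / (sqrt (2 \<pi>) \<sigma>) \<le> 1 / (2 \<sigma>)\<close> and the interval has length \<open>2 h\<close>.
\<close>

lemma centered_gaussian_small_ball:
  assumes Y: "centered_gaussian_rv M Y" and V: "0 < expectation (\<lambda>\<omega>. (Y \<omega>)\<^sup>2)" and h: "0 \<le> h"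
  shows "prob {\<omega>\<in>space M. \<bar>Y \<omega> - c\<bar> \<le> h} \<le> h / sqrt (expectation (\<lambda>\<omega>. (Y \<omega>)\<^sup>2))"
proof -
  have [measurable]: "Y \<in> borel_measurable M" using Y by (simp add: centered_gaussian_rv_def)
  have "\<not> (AE \<omega> in M. Y \<omega> = 0)"
  proof
    assume "AE \<omega> in M. Y \<omega> = 0"
    then have "AE \<omega> in M. (Y \<omega>)\<^sup>2 = 0" by eventually_elim simp
    then have "expectation (\<lambda>\<omega>. (Y \<omega>)\<^sup>2) = 0" by (rule integral_eq_zero_AE)
    with V show False by simp
  qed
  with Y obtain \<sigma> where \<sigma>: "0 < \<sigma>" and D: "distributed M lborel Y (normal_density 0 \<sigma>)"
    by (auto simp: centered_gaussian_rv_def)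
  have v: "expectation (\<lambda>\<omega>. (Y \<omega>)\<^sup>2) = \<sigma>\<^sup>2"
    using distributed_integral[OF D, of "\<lambda>x. x\<^sup>2"] \<sigma>
      integral_normal_moment_even[OF \<sigma>, of 0 1] by (simp add: fact_numeral normal_density_nonneg)
  have "4 \<le> 2 * pi" using pi_ge_two by simp
  then have "2 \<le> sqrt (2 * pi)" by (intro real_le_rsqrt) simp
  then have "2 * \<sigma> \<le> sqrt (2 * pi) * \<sigma>" using \<sigma> by (intro mult_right_mono) auto
  moreover have "sqrt (2 * pi * \<sigma>\<^sup>2) = sqrt (2 * pi) * \<sigma>" using \<sigma> by (simp add: real_sqrt_mult)
  ultimately have root: "2 * \<sigma> \<le> sqrt (2 * pi * \<sigma>\<^sup>2)" by simp
  have peak: "normal_density 0 \<sigma> x \<le> 1 / (2 * \<sigma>)" for x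
  proof -
    have "normal_density 0 \<sigma> x \<le> 1 / sqrt (2 * pi * \<sigma>\<^sup>2) * 1"
      unfolding normal_density_def by (intro mult_left_mono) auto
    also have "\<dots> \<le> 1 / (2 * \<sigma>)" using root \<sigma> by (simp add: frac_le)
    finally show ?thesis .
  qed
  have "emeasure M {\<omega>\<in>space M. \<bar>Y \<omega> - c\<bar> \<le> h} = emeasure M (Y -` {c - h..c + h} \<inter> space M)"
    by (rule arg_cong[where f="emeasure M"]) (auto simp: abs_le_iff)
  also have "\<dots> = (\<integral>\<^sup>+x. ennreal (normal_density 0 \<sigma> x) * indicator {c - h..c + h} x \<partial>lborel)"
    by (rule distributed_emeasure[OF D]) simp
  also have "\<dots> \<le> (\<integral>\<^sup>+x. ennreal (1 / (2 * \<sigma>)) * indicator {c - h..c + h} x \<partial>lborel)"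
    using peak by (intro nn_integral_mono mult_right_mono ennreal_leI) auto
  also have "\<dots> = ennreal (1 / (2 * \<sigma>)) * ennreal (2 * h)"
    using h by (subst nn_integral_cmult) auto
  also have "\<dots> = ennreal (h / \<sigma>)"
    using h \<sigma> by (simp add: ennreal_mult[symmetric])
  finally have "prob {\<omega>\<in>space M. \<bar>Y \<omega> - c\<bar> \<le> h} \<le> h / \<sigma>"
    using h \<sigma> by (simp add: emeasure_eq_measure)
  then show ?thesis using v \<sigma> by simp
qed

text \<open>
  If the increment is at least as large as the distance of \<open>X\<close> from \<open>c\<close>, then either \<open>X\<close> is close to \<open>c\<close>
  or the increment is large. Each of these events concerns a single Gaussian variable.
\<close>

lemma centered_gaussian_straddle:
  assumes X: "centered_gaussian_rv M X" and XY: "centered_gaussian_rv M (\<lambda>\<omega>. X \<omega> - Y \<omega>)"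
    and V: "0 < expectation (\<lambda>\<omega>. (X \<omega>)\<^sup>2)" and h: "0 < h"
  shows "prob {\<omega>\<in>space M. \<bar>X \<omega> - c\<bar> \<le> \<bar>X \<omega> - Y \<omega>\<bar>}
    \<le> h / sqrt (expectation (\<lambda>\<omega>. (X \<omega>)\<^sup>2))
      + fact (2 * k) / (2 ^ k * fact k) * expectation (\<lambda>\<omega>. (X \<omega> - Y \<omega>)\<^sup>2) ^ k / h ^ (2 * k)"
proof -
  have [measurable]: "X \<in> borel_measurable M" "(\<lambda>\<omega>. X \<omega> - Y \<omega>) \<in> borel_measurable M"
    using X XY by (simp_all add: centered_gaussian_rv_def)
  let ?A = "{\<omega>\<in>space M. \<bar>X \<omega> - c\<bar> \<le> h}" and ?B = "{\<omega>\<in>space M. h \<le> \<bar>X \<omega> - Y \<omega>\<bar>}"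
  have "prob {\<omega>\<in>space M. \<bar>X \<omega> - c\<bar> \<le> \<bar>X \<omega> - Y \<omega>\<bar>} \<le> prob (?A \<union> ?B)"
    by (rule finite_measure_mono) auto
  also have "\<dots> \<le> prob ?A + prob ?B"
    by (rule measure_Un_le) auto
  finally show ?thesis
    using centered_gaussian_small_ball[OF X V less_imp_le[OF h], of c]
      centered_gaussian_tail[OF XY h, of k] by linarith
qed

section \<open>Variances in a Gaussian process with continuous paths\<close>

lemma gaussian_process_rv:
  assumes "centered_gaussian_process M T X" "t \<in> {0..T}"
  shows "centered_gaussian_rv M (X t)"
  using assms(1)[unfolded centered_gaussian_process_def, rule_format, of "{t}" "\<lambda>_. 1"] assms(2)
  by simp

lemma gaussian_process_increment:
  assumes "centered_gaussian_process M T X" "s \<in> {0..T}" "t \<in> {0..T}"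
  shows "centered_gaussian_rv M (\<lambda>\<omega>. X t \<omega> - X s \<omega>)"
proof (cases "s = t")
  case False
  then have "(\<Sum>r\<in>{t, s}. (if r = t then 1 else - 1) * X r \<omega>) = X t \<omega> - X s \<omega>" for \<omega>
    by auto
  then show ?thesis
    using assms(1)[unfolded centered_gaussian_process_def, rule_format,
        of "{t, s}" "\<lambda>r. if r = t then 1 else - 1"] assms(2,3)
    by simp
qed (simp add: centered_gaussian_rv_def)

lemma gaussian_square_integrable:
  assumes "centered_gaussian_rv M Y"
  shows "integrable M (\<lambda>\<omega>. (Y \<omega>)\<^sup>2)"
  using centered_gaussian_even_moment(1)[OF assms, of 1] by simp

lemma var_fun_le_incr_var:
  assumes G: "centered_gaussian_process M T X" and s: "s \<in> {0..T}" and t: "t \<in> {0..T}"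
  shows "var_fun M X t \<le> 2 * var_fun M X s + 2 * incr_var M X t s"
proof -
  note int = gaussian_square_integrable[OF gaussian_process_rv[OF G s]]
    gaussian_square_integrable[OF gaussian_process_rv[OF G t]]
    gaussian_square_integrable[OF gaussian_process_increment[OF G s t]]
  have "var_fun M X t \<le> expectation (\<lambda>\<omega>. 2 * (X s \<omega>)\<^sup>2 + 2 * (X t \<omega> - X s \<omega>)\<^sup>2)"
    unfolding var_fun_def
  proof (rule integral_mono)
    fix \<omega>
    have "0 \<le> (X t \<omega> - 2 * X s \<omega>)\<^sup>2" by simp
    then show "(X t \<omega>)\<^sup>2 \<le> 2 * (X s \<omega>)\<^sup>2 + 2 * (X t \<omega> - X s \<omega>)\<^sup>2"
      by (simp add: power2_eq_square algebra_simps)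
  qed (use int in auto)
  also have "\<dots> = 2 * var_fun M X s + 2 * incr_var M X t s"
    using int by (simp add: var_fun_def incr_var_def)
  finally show ?thesis .
qed

lemma incr_var_le_var_fun:
  assumes G: "centered_gaussian_process M T X" and s: "s \<in> {0..T}" and t: "t \<in> {0..T}"
  shows "incr_var M X t s \<le> 2 * var_fun M X t + 2 * var_fun M X s"
proof -
  note int = gaussian_square_integrable[OF gaussian_process_rv[OF G s]]
    gaussian_square_integrable[OF gaussian_process_rv[OF G t]]
    gaussian_square_integrable[OF gaussian_process_increment[OF G s t]]
  have "incr_var M X t s \<le> expectation (\<lambda>\<omega>. 2 * (X t \<omega>)\<^sup>2 + 2 * (X s \<omega>)\<^sup>2)"
    unfolding incr_var_def
  proof (rule integral_mono)
    fix \<omega>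
    have "0 \<le> (X t \<omega> + X s \<omega>)\<^sup>2" by simp
    then show "(X t \<omega> - X s \<omega>)\<^sup>2 \<le> 2 * (X t \<omega>)\<^sup>2 + 2 * (X s \<omega>)\<^sup>2"
      by (simp add: power2_eq_square algebra_simps)
  qed (use int in auto)
  also have "\<dots> = 2 * var_fun M X t + 2 * var_fun M X s"
    using int by (simp add: var_fun_def)
  finally show ?thesis .
qed

text \<open>
  Almost every path is bounded on \<open>[0,T]\<close>, so there is an \<open>n\<close> for which, with probability more than
  one half, all \<open>\<bar>X\<^sub>t\<bar>\<close> are at most \<open>n\<close> simultaneously. A Gaussian variable of standard deviation \<open>\<sigma>\<close> stays in \<open>[-n,n]\<close>
  with probability at most \<open>n / \<sigma>\<close>, which forces \<open>\<sigma> \<le> 2 n\<close> at every time \<open>t\<close>.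
\<close>

lemma var_fun_bounded:
  assumes T: "0 \<le> T" and G: "centered_gaussian_process M T X"
    and cont: "AE \<omega> in M. continuous_on {0..T} (\<lambda>t. X t \<omega>)"
  obtains B where "0 < B" "\<And>t. t \<in> {0..T} \<Longrightarrow> var_fun M X t \<le> B"
proof -
  have meas: "X t \<in> borel_measurable M" if "t \<in> {0..T}" for t
    using gaussian_process_rv[OF G that] by (simp add: centered_gaussian_rv_def)
  obtain Z where [measurable]: "\<And>t. Z t \<in> borel_measurable M"
    and Zcont: "\<And>\<omega>. continuous_on UNIV (\<lambda>t. Z t \<omega>)"
    and Zbd: "\<And>\<omega>. bounded (range (\<lambda>t. Z t \<omega>))"
    and ZX: "AE \<omega> in M. \<forall>t\<in>{0..T}. Z t \<omega> = X t \<omega>"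
    using continuous_modification[OF T meas cont] by blast
  \<comment> \<open>Only rational times are listed, to make the event measurable; continuity covers the others.\<close>
  define A where "A n = {\<omega>\<in>space M. \<forall>q::rat. \<bar>Z (of_rat q) \<omega>\<bar> \<le> real n}" for n
  have [measurable]: "A n \<in> events" for n unfolding A_def by measurable
  have path: "\<bar>Z t \<omega>\<bar> \<le> real n" if "\<omega> \<in> A n" for t \<omega> n
  proof -
    have "closed {t. \<bar>Z t \<omega>\<bar> \<le> real n}"
      using Zcont[of \<omega>] by (intro closed_Collect_le continuous_intros)
    moreover have "\<rat> \<subseteq> {t. \<bar>Z t \<omega>\<bar> \<le> real n}"
      using that by (auto simp: A_def Rats_def)
    ultimately have "closure \<rat> \<subseteq> {t. \<bar>Z t \<omega>\<bar> \<le> real n}"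
      by (intro closure_minimal)
    then show ?thesis by (auto simp: Rats_closure_real)
  qed
  have "(\<lambda>n. prob (A n)) \<longlonglongrightarrow> prob (\<Union>n. A n)"
    by (intro finite_Lim_measure_incseq) (auto simp: incseq_def A_def intro: order_trans)
  moreover have "(\<Union>n. A n) = space M"
  proof safe
    fix \<omega> assume \<omega>: "\<omega> \<in> space M"
    obtain b where b: "\<And>t. \<bar>Z t \<omega>\<bar> \<le> b"
      using Zbd[of \<omega>] by (auto simp: bounded_iff)
    obtain n where "b \<le> real n" using real_arch_simple by blast
    then have "\<omega> \<in> A n" using \<omega> b by (auto simp: A_def intro: order_trans)
    then show "\<omega> \<in> (\<Union>n. A n)" by blast
  qed (auto simp: A_def)
  ultimately have "(\<lambda>n. prob (A n)) \<longlonglongrightarrow> 1" by (simp add: prob_space)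
  then have "\<forall>\<^sub>F n in sequentially. 1 / 2 < prob (A n)"
    by (rule order_tendstoD) simp
  then obtain n where n: "1 / 2 < prob (A n)"
    by (auto simp: eventually_sequentially)
  have "var_fun M X t \<le> (2 * real n)\<^sup>2" if t: "t \<in> {0..T}" for t
  proof (cases "0 < var_fun M X t")
    case True
    have [measurable]: "X t \<in> borel_measurable M" by (rule meas[OF t])
    have "prob (A n) \<le> prob {\<omega>\<in>space M. \<bar>X t \<omega> - 0\<bar> \<le> real n}"
    proof (rule finite_measure_mono_AE)
      show "AE \<omega> in M. \<omega> \<in> A n \<longrightarrow> \<omega> \<in> {\<omega>\<in>space M. \<bar>X t \<omega> - 0\<bar> \<le> real n}"
        using ZX AE_space
      proof eventually_elim
        case (elim \<omega>)
        then show ?case using path[of \<omega> n t] t by auto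
      qed
    qed measurable
    also have "\<dots> \<le> real n / sqrt (var_fun M X t)"
      using centered_gaussian_small_ball[OF gaussian_process_rv[OF G t], of "real n" 0] True
      by (simp add: var_fun_def)
    finally have "1 / 2 < real n / sqrt (var_fun M X t)" using n by linarith
    then have "sqrt (var_fun M X t) \<le> 2 * real n"
      using True by (simp add: field_simps)
    then show ?thesis
      using power_mono[of "sqrt (var_fun M X t)" "2 * real n" 2] True by simp
  qed (auto intro: order_trans[of _ 0])
  then have "var_fun M X t \<le> (2 * real n)\<^sup>2 + 1" if "t \<in> {0..T}" for t
    using that by force
  then show thesis by (intro that[of "(2 * real n)\<^sup>2 + 1"]) (auto intro: add_nonneg_pos)
qed

text \<open>
  Condition (ii) controls short increments. The long ones have bounded variance, and there
  \<open>(t-s)\<^sup>2\<^sup>\<alpha>\<close> is bounded away from zero.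
\<close>

lemma class_X_incr_var_le:
  assumes T: "0 < T" and \<alpha>: "0 < \<alpha>" and X: "class_X M T \<alpha> X"
  obtains K where "0 < K"
    "\<And>s t. 0 \<le> s \<Longrightarrow> s < t \<Longrightarrow> t \<le> T \<Longrightarrow> incr_var M X t s \<le> K * (t - s) powr (2 * \<alpha>)"
proof -
  have G: "centered_gaussian_process M T X"
    and cont: "AE \<omega> in M. continuous_on {0..T} (\<lambda>t. X t \<omega>)"
    using X by (auto simp: class_X_def)
  obtain C where C: "0 < C" "(\<lambda>t. sup_incr_var M T X t - C * t powr (2 * \<alpha>))
      \<in> o[at_right 0](\<lambda>t. t powr (2 * \<alpha>))"
    using X by (auto simp: class_X_def)
  obtain B where B: "0 < B" "\<And>t. t \<in> {0..T} \<Longrightarrow> var_fun M X t \<le> B"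
    using var_fun_bounded[OF less_imp_le[OF T] G cont] by blast
  have W4B: "incr_var M X t s \<le> 4 * B" if "s \<in> {0..T}" "t \<in> {0..T}" for s t
    using incr_var_le_var_fun[OF G that] B(2)[OF that(1)] B(2)[OF that(2)] by linarith
  have "\<forall>\<^sub>F t in at_right 0. norm (sup_incr_var M T X t - C * t powr (2 * \<alpha>))
      \<le> 1 * norm (t powr (2 * \<alpha>))"
    by (rule landau_o.smallD[OF C(2)]) simp
  then obtain d where d: "0 < d" and
    small: "\<And>t. 0 < t \<Longrightarrow> t < d \<Longrightarrow> \<bar>sup_incr_var M T X t - C * t powr (2 * \<alpha>)\<bar> \<le> t powr (2 * \<alpha>)"
    by (auto simp: eventually_at_right_field)
  define K where "K = max (C + 1) (4 * B / d powr (2 * \<alpha>))"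
  show thesis
  proof
    show "0 < K" using C(1) by (simp add: K_def)
    fix s t assume st: "0 \<le> s" "s < t" "t \<le> T"
    show "incr_var M X t s \<le> K * (t - s) powr (2 * \<alpha>)"
    proof (cases "t - s < d")
      case True
      have "incr_var M X t s = incr_var M X ((t - s) + s) s" by simp
      also have "\<dots> \<le> sup_incr_var M T X (t - s)"
        unfolding sup_incr_var_def
      proof (rule cSUP_upper)
        show "bdd_above ((\<lambda>s'. incr_var M X (t - s + s') s') ` {0..T - (t - s)})"
          by (rule bdd_aboveI2[of _ _ "4 * B"], rule W4B) (use st in auto)
      qed (use st in auto)
      also have "\<dots> \<le> (C + 1) * (t - s) powr (2 * \<alpha>)"
        using small[of "t - s"] True st by (simp add: algebra_simps)
      also have "\<dots> \<le> K * (t - s) powr (2 * \<alpha>)"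
        by (intro mult_right_mono) (auto simp: K_def)
      finally show ?thesis .
    next
      case False
      have "incr_var M X t s \<le> 4 * B / d powr (2 * \<alpha>) * d powr (2 * \<alpha>)"
        using W4B[of s t] st d by simp
      also have "\<dots> \<le> 4 * B / d powr (2 * \<alpha>) * (t - s) powr (2 * \<alpha>)"
        using False d \<alpha> B(1) by (intro mult_left_mono powr_mono2) auto
      also have "\<dots> \<le> K * (t - s) powr (2 * \<alpha>)"
        by (intro mult_right_mono) (auto simp: K_def)
      finally show ?thesis .
    qed
  qed
qed

text \<open>
  Near zero this is condition (iii). Away from zero the variance is positive by condition (i) at
  \<open>s = t\<close>, and, since the increment variance is small for nearby times, a sequence of times with variance
  tending to zero would accumulate at a time of variance zero.
\<close>

lemma class_X_var_fun_ge:
  assumes T: "0 < T" and \<alpha>: "0 < \<alpha>" and X: "class_X M T \<alpha> X"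
  obtains c where "0 < c" "\<And>s. s \<in> {0..T} \<Longrightarrow> c * s\<^sup>2 \<le> var_fun M X s"
proof -
  have G: "centered_gaussian_process M T X" using X by (auto simp: class_X_def)
  have pos: "0 < var_fun M X s" if "0 < s" "s \<le> T" for s
    using X that by (auto simp: class_X_def cov_fun_def var_fun_def power2_eq_square)
  obtain c0 d where c0: "0 < c0" "0 < d"
    "\<And>s. s \<in> {0..T} \<Longrightarrow> s \<le> d \<Longrightarrow> c0 * s\<^sup>2 \<le> var_fun M X s"
    using X unfolding class_X_def by metis
  obtain K where K: "0 < K"
    "\<And>s t. 0 \<le> s \<Longrightarrow> s < t \<Longrightarrow> t \<le> T \<Longrightarrow> incr_var M X t s \<le> K * (t - s) powr (2 * \<alpha>)"
    using class_X_incr_var_le[OF T \<alpha> X] by blast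
  have W: "incr_var M X t s \<le> K * \<bar>t - s\<bar> powr (2 * \<alpha>)" if "s \<in> {0..T}" "t \<in> {0..T}" for s t
  proof -
    have "incr_var M X t s = incr_var M X s t" by (simp add: incr_var_def power2_commute)
    then show ?thesis
      using K(2)[of s t] K(2)[of t s] that
      by (cases s t rule: linorder_cases) (auto simp: incr_var_def)
  qed
  have "\<exists>m>0. \<forall>s\<in>{d..T}. m \<le> var_fun M X s"
  proof (rule ccontr)
    assume "\<not> (\<exists>m>0. \<forall>s\<in>{d..T}. m \<le> var_fun M X s)"
    then have "\<forall>n::nat. \<exists>s\<in>{d..T}. var_fun M X s < inverse (real (Suc n))"
      by (metis inverse_positive_iff_positive not_le of_nat_0_less_iff zero_less_Suc)
    then obtain S where S: "\<And>n. S n \<in> {d..T}" "\<And>n. var_fun M X (S n) < inverse (real (Suc n))"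
      by metis
    obtain l r where l: "l \<in> {d..T}" and r: "strict_mono (r :: nat \<Rightarrow> nat)"
      and lim: "(S \<circ> r) \<longlonglongrightarrow> l"
      using compact_Icc[of d T] S(1) unfolding compact_def by metis
    have "(\<lambda>n. 2 * inverse (real (Suc (r n))) + 2 * (K * \<bar>l - S (r n)\<bar> powr (2 * \<alpha>)))
        \<longlonglongrightarrow> 2 * 0 + 2 * (K * 0)"
    proof (intro tendsto_intros)
      show "(\<lambda>n. inverse (real (Suc (r n)))) \<longlonglongrightarrow> 0"
        using LIMSEQ_subseq_LIMSEQ[OF LIMSEQ_inverse_real_of_nat r] by (simp add: o_def)
      have "(\<lambda>n. \<bar>l - S (r n)\<bar>) \<longlonglongrightarrow> \<bar>l - l\<bar>"
        using lim by (intro tendsto_intros) (simp add: o_def)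
      then have "(\<lambda>n. \<bar>l - S (r n)\<bar> powr (2 * \<alpha>)) \<longlonglongrightarrow> 0 powr (2 * \<alpha>)"
        using \<alpha> by (intro tendsto_powr') auto
      then show "(\<lambda>n. \<bar>l - S (r n)\<bar> powr (2 * \<alpha>)) \<longlonglongrightarrow> 0" by simp
    qed
    moreover have "var_fun M X l
        \<le> 2 * inverse (real (Suc (r n))) + 2 * (K * \<bar>l - S (r n)\<bar> powr (2 * \<alpha>))" for n
    proof -
      have in0T: "l \<in> {0..T}" "S (r n) \<in> {0..T}" using l S(1)[of "r n"] c0(2) by auto
      show ?thesis
        using var_fun_le_incr_var[OF G in0T(2,1)] S(2)[of "r n"] W[OF in0T(2,1)] by linarith
    qed
    ultimately have "var_fun M X l \<le> 2 * 0 + 2 * (K * 0)"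
      by (intro LIMSEQ_le_const) auto
    then show False using pos[of l] l c0(2) by auto
  qed
  then obtain m where m: "0 < m" "\<And>s. s \<in> {d..T} \<Longrightarrow> m \<le> var_fun M X s" by blast
  show thesis
  proof
    show "0 < min c0 (m / T\<^sup>2)" using c0 m T by simp
    fix s assume s: "s \<in> {0..T}"
    show "min c0 (m / T\<^sup>2) * s\<^sup>2 \<le> var_fun M X s"
    proof (cases "s \<le> d")
      case True
      have "min c0 (m / T\<^sup>2) * s\<^sup>2 \<le> c0 * s\<^sup>2" by (intro mult_right_mono) auto
      then show ?thesis using c0(3)[OF s True] by linarith
    next
      case False
      have "min c0 (m / T\<^sup>2) * s\<^sup>2 \<le> m / T\<^sup>2 * T\<^sup>2"
        using s m(1) by (intro mult_mono power_mono) auto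
      then show ?thesis using m(2)[of s] s False T by simp
    qed
  qed
qed

end

section \<open>The straddling probability\<close>

text \<open>
  The threshold \<open>h = (s-u)\<^sup>\<gamma>\<close> makes the small-ball term \<open>(s-u)\<^sup>\<gamma> / sqrt (V(s))\<close>, of the required form. The
  tail term is of order \<open>(s-u)\<close> to the power \<open>2 k (\<alpha> - \<gamma>)\<close>, and \<open>k\<close> is taken so large that this exponent
  is at least \<open>\<gamma>\<close>; the missing factor \<open>1 / s\<close> is at least \<open>1 / T\<close>.
\<close>

lemma (in prob_space) class_X_straddle:
  assumes T: "0 < T" and \<alpha>: "0 < \<alpha>" and X: "class_X M T \<alpha> X" and \<gamma>: "0 < \<gamma>" "\<gamma> < \<alpha>"
  obtains B where "0 \<le> B" "\<And>u s c. 0 \<le> u \<Longrightarrow> u < s \<Longrightarrow> s \<le> T \<Longrightarrow>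
    prob {\<omega>\<in>space M. \<bar>X s \<omega> - c\<bar> \<le> \<bar>X s \<omega> - X u \<omega>\<bar>} \<le> B * ((s - u) powr \<gamma> / s)"
proof -
  have G: "centered_gaussian_process M T X" using X by (auto simp: class_X_def)
  obtain K where K: "0 < K"
    "\<And>s t. 0 \<le> s \<Longrightarrow> s < t \<Longrightarrow> t \<le> T \<Longrightarrow> incr_var M X t s \<le> K * (t - s) powr (2 * \<alpha>)"
    using class_X_incr_var_le[OF T \<alpha> X] by blast
  obtain a where a: "0 < a" "\<And>s. s \<in> {0..T} \<Longrightarrow> a * s\<^sup>2 \<le> var_fun M X s"
    using class_X_var_fun_ge[OF T \<alpha> X] by blast
  obtain k :: nat where k: "\<gamma> / (2 * (\<alpha> - \<gamma>)) \<le> real k"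
    using real_arch_simple by blast
  \<comment> \<open>The surplus of the exponent in the tail term over the required exponent \<open>\<gamma>\<close>.\<close>
  define r where "r = 2 * real k * (\<alpha> - \<gamma>) - \<gamma>"
  have r: "0 \<le> r" using k \<gamma>(2) by (simp add: r_def field_simps)
  define A :: real where "A = fact (2 * k) / (2 ^ k * fact k)"
  have A: "0 \<le> A" by (simp add: A_def)
  define B where "B = 1 / sqrt a + A * K ^ k * T powr r * T"
  show thesis
  proof
    show "0 \<le> B" using a(1) A K(1) T by (simp add: B_def)
    fix u s c :: real assume us: "0 \<le> u" "u < s" "s \<le> T"
    define d where "d = s - u"
    have d: "0 < d" "d \<le> T" and s: "0 < s" using us by (auto simp: d_def)
    have in0T: "u \<in> {0..T}" "s \<in> {0..T}" using us by auto
    have V: "a * s\<^sup>2 \<le> var_fun M X s" by (rule a(2)[OF in0T(2)])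
    have aV: "0 < a * s\<^sup>2" using a(1) s by simp
    have "d powr \<gamma> / sqrt (var_fun M X s) \<le> d powr \<gamma> / sqrt (a * s\<^sup>2)"
      using V aV by (intro divide_left_mono) auto
    also have "\<dots> = 1 / sqrt a * (d powr \<gamma> / s)"
      using s by (simp add: real_sqrt_mult)
    finally have near: "d powr \<gamma> / sqrt (var_fun M X s) \<le> 1 / sqrt a * (d powr \<gamma> / s)" .
    have W: "0 \<le> incr_var M X s u" by (simp add: incr_var_def)
    have "incr_var M X s u ^ k / (d powr \<gamma>) ^ (2 * k) \<le> (K * d powr (2 * \<alpha>)) ^ k / (d powr \<gamma>) ^ (2 * k)"
      using K(2)[OF us] W by (intro divide_right_mono power_mono) (auto simp: d_def)
    also have "\<dots> = K ^ k * (d powr r * d powr \<gamma>)"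
    proof -
      have "(d powr (2 * \<alpha>)) ^ k / (d powr \<gamma>) ^ (2 * k)
          = d powr (2 * real k * \<alpha>) / d powr (2 * real k * \<gamma>)"
        using d(1) by (simp add: powr_power mult_ac)
      also have "\<dots> = d powr (r + \<gamma>)"
        by (simp add: powr_diff[symmetric] r_def algebra_simps)
      also have "\<dots> = d powr r * d powr \<gamma>" by (rule powr_add)
      finally show ?thesis
        by (simp only: power_mult_distrib times_divide_eq_right[symmetric])
    qed
    also have "\<dots> \<le> K ^ k * (T powr r * d powr \<gamma>)"
      using d r K(1) by (intro mult_left_mono mult_right_mono powr_mono2) auto
    also have "\<dots> \<le> K ^ k * (T powr r * (T * (d powr \<gamma> / s)))"
    proof -
      have "d powr \<gamma> * s \<le> d powr \<gamma> * T" using us(3) by (intro mult_left_mono) auto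
      then have "d powr \<gamma> \<le> T * (d powr \<gamma> / s)" using s by (simp add: field_simps)
      then show ?thesis using K(1) by (intro mult_left_mono) auto
    qed
    finally have "A * (incr_var M X s u ^ k / (d powr \<gamma>) ^ (2 * k))
        \<le> A * (K ^ k * (T powr r * (T * (d powr \<gamma> / s))))"
      using A by (rule mult_left_mono)
    then have far: "A * incr_var M X s u ^ k / (d powr \<gamma>) ^ (2 * k)
        \<le> A * K ^ k * T powr r * T * (d powr \<gamma> / s)"
      by (simp add: mult_ac)
    have "prob {\<omega>\<in>space M. \<bar>X s \<omega> - c\<bar> \<le> \<bar>X s \<omega> - X u \<omega>\<bar>}
        \<le> d powr \<gamma> / sqrt (var_fun M X s) + A * incr_var M X s u ^ k / (d powr \<gamma>) ^ (2 * k)"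
      unfolding A_def var_fun_def incr_var_def
      by (rule centered_gaussian_straddle[OF gaussian_process_rv[OF G in0T(2)]
            gaussian_process_increment[OF G in0T]])
         (use V aV d in \<open>auto simp: var_fun_def\<close>)
    also have "\<dots> \<le> B * (d powr \<gamma> / s)"
      using add_mono[OF near far] by (simp only: B_def distrib_right)
    finally show "prob {\<omega>\<in>space M. \<bar>X s \<omega> - c\<bar> \<le> \<bar>X s \<omega> - X u \<omega>\<bar>}
        \<le> B * ((s - u) powr \<gamma> / s)" by (simp add: d_def)
  qed
qed

section \<open>Finiteness of the Besov norm\<close>

lemma nn_integral_powr_from_0:
  assumes "- 1 < a" "0 \<le> c"
  shows "(\<integral>\<^sup>+x\<in>{0..c}. ennreal (x powr a) \<partial>lborel) = ennreal (c powr (a + 1) / (a + 1))"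
  by (rule nn_integral_has_integral_lebesgue'[OF _ has_integral_powr_from_0[OF assms]]) simp

lemma nn_integral_powr_reflected:
  assumes "- 1 < a" "0 \<le> c"
  shows "(\<integral>\<^sup>+x\<in>{0..c}. ennreal ((c - x) powr a) \<partial>lborel) = ennreal (c powr (a + 1) / (a + 1))"
proof -
  have "(\<integral>\<^sup>+x\<in>{0..c}. ennreal (x powr a) \<partial>lborel)
      = ennreal \<bar>- 1\<bar> * (\<integral>\<^sup>+x. ennreal ((c + - 1 * x) powr a) * indicator {0..c} (c + - 1 * x) \<partial>lborel)"
    by (rule nn_integral_real_affine) auto
  also have "\<dots> = (\<integral>\<^sup>+x\<in>{0..c}. ennreal ((c - x) powr a) \<partial>lborel)"
    by (auto intro!: nn_integral_cong simp: indicator_def)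
  finally show ?thesis using nn_integral_powr_from_0[OF assms] by simp
qed

text \<open>
  With \<open>p = \<gamma> - \<beta> > 0\<close>, integrating \<open>(s-u)\<^sup>p\<^sup>-\<^sup>1 / s\<close> over \<open>u\<close> leaves \<open>s\<^sup>p\<^sup>-\<^sup>1 / p\<close>: the inner integral
  gains exactly the power of \<open>s\<close> that makes the singularity \<open>1 / s\<close> integrable.
\<close>

lemma besov_kernel_finite:
  assumes T: "0 \<le> T" and B: "0 \<le> B" and \<gamma>: "\<beta> < \<gamma>"
  shows "(\<integral>\<^sup>+s\<in>{0..T}. (\<integral>\<^sup>+u\<in>{0..s}.
            ennreal (B * ((s - u) powr \<gamma> / s) / (s - u) powr (1 + \<beta>)) \<partial>lborel) \<partial>lborel) < \<infinity>"
    (is "?I < \<infinity>")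
proof -
  define p where "p = \<gamma> - \<beta>"
  have p: "0 < p" using \<gamma> by (simp add: p_def)
  have inner: "(\<integral>\<^sup>+u\<in>{0..s}. ennreal (B * ((s - u) powr \<gamma> / s) / (s - u) powr (1 + \<beta>)) \<partial>lborel)
      \<le> ennreal (B / p) * ennreal (s powr (p - 1))" if s: "0 \<le> s" for s
  proof (cases "s = 0")
    case False
    with s have s: "0 < s" by simp
    have "(\<integral>\<^sup>+u\<in>{0..s}. ennreal (B * ((s - u) powr \<gamma> / s) / (s - u) powr (1 + \<beta>)) \<partial>lborel)
        = (\<integral>\<^sup>+u. ennreal (B / s) * (ennreal ((s - u) powr (p - 1)) * indicator {0..s} u) \<partial>lborel)"
    proof (rule nn_integral_cong)
      fix u
      have "(s - u) powr (p - 1) = (s - u) powr \<gamma> / (s - u) powr (1 + \<beta>)"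
        by (simp add: p_def powr_diff[symmetric] algebra_simps)
      then have "B * ((s - u) powr \<gamma> / s) / (s - u) powr (1 + \<beta>) = B / s * (s - u) powr (p - 1)"
        by simp
      then show "ennreal (B * ((s - u) powr \<gamma> / s) / (s - u) powr (1 + \<beta>)) * indicator {0..s} u
          = ennreal (B / s) * (ennreal ((s - u) powr (p - 1)) * indicator {0..s} u)"
        using B s by (simp only: ennreal_mult mult.assoc[symmetric] divide_nonneg_pos powr_ge_zero)
    qed
    also have "\<dots> = ennreal (B / s) * ennreal (s powr p / p)"
      using nn_integral_powr_reflected[of "p - 1" s] p s by (subst nn_integral_cmult) auto
    also have "\<dots> = ennreal (B / p * s powr (p - 1))"
      using B s p by (simp add: ennreal_mult[symmetric] powr_diff mult_ac)
    also have "\<dots> = ennreal (B / p) * ennreal (s powr (p - 1))"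
      by (rule ennreal_mult) (use B p in auto)
    finally show ?thesis by simp
  qed simp
  have "?I \<le> (\<integral>\<^sup>+s. ennreal (B / p) * (ennreal (s powr (p - 1)) * indicator {0..T} s) \<partial>lborel)"
    by (intro nn_integral_mono) (use inner in \<open>auto simp: indicator_def\<close>)
  also have "\<dots> = ennreal (B / p) * ennreal (T powr p / p)"
    using nn_integral_powr_from_0[of "p - 1" T] p T by (subst nn_integral_cmult) auto
  also have "\<dots> < \<infinity>" by (simp add: ennreal_mult_less_top)
  finally show ?thesis .
qed

text \<open>
  Fubini's theorem turns the bound on mean increments into finiteness of the expected double integral,
  hence of almost every double integral.
\<close>

lemma (in prob_space) AE_besov_seminorm_finite:
  fixes Y :: "real \<Rightarrow> 'a \<Rightarrow> real"
  assumes Y[measurable]: "(\<lambda>(t, \<omega>). Y t \<omega>) \<in> borel_measurable (borel \<Otimes>\<^sub>M M)"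
    and T: "0 \<le> T" and B: "0 \<le> B" and \<gamma>: "\<beta> < \<gamma>"
    and incr: "\<And>u s. 0 \<le> u \<Longrightarrow> u < s \<Longrightarrow> s \<le> T \<Longrightarrow>
      (\<integral>\<^sup>+\<omega>. ennreal \<bar>Y u \<omega> - Y s \<omega>\<bar> \<partial>M) \<le> ennreal (B * ((s - u) powr \<gamma> / s))"
  shows "AE \<omega> in M. (\<integral>\<^sup>+s\<in>{0..T}. (\<integral>\<^sup>+u\<in>{0..s}.
      ennreal (\<bar>Y u \<omega> - Y s \<omega>\<bar> / (s - u) powr (1 + \<beta>)) \<partial>lborel) \<partial>lborel) < \<infinity>"
proof -
  interpret P: pair_sigma_finite M "lborel :: real measure" ..
  let ?f = "\<lambda>\<omega> s u. ennreal (\<bar>Y u \<omega> - Y s \<omega>\<bar> / (s - u) powr (1 + \<beta>)) * indicator {0..s} u"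
  let ?F = "\<lambda>\<omega>. \<integral>\<^sup>+s. (\<integral>\<^sup>+u. ?f \<omega> s u \<partial>lborel) * indicator {0..T} s \<partial>lborel"
  have "(\<integral>\<^sup>+\<omega>. ?F \<omega> \<partial>M) = (\<integral>\<^sup>+s. (\<integral>\<^sup>+\<omega>. (\<integral>\<^sup>+u. ?f \<omega> s u \<partial>lborel) * indicator {0..T} s \<partial>M) \<partial>lborel)"
    by (rule P.Fubini'[symmetric], unfold indicator_def atLeastAtMost_iff of_bool_def) measurable
  also have "\<dots> = (\<integral>\<^sup>+s. (\<integral>\<^sup>+\<omega>. (\<integral>\<^sup>+u. ?f \<omega> s u \<partial>lborel) \<partial>M) * indicator {0..T} s \<partial>lborel)"
    by (intro nn_integral_cong nn_integral_multc) measurable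
  also have "\<dots> = (\<integral>\<^sup>+s. (\<integral>\<^sup>+u. (\<integral>\<^sup>+\<omega>. ?f \<omega> s u \<partial>M) \<partial>lborel) * indicator {0..T} s \<partial>lborel)"
    by (intro nn_integral_cong arg_cong2[where f="(*)"] refl P.Fubini'[symmetric]) measurable
  also have "\<dots> \<le> (\<integral>\<^sup>+s\<in>{0..T}. (\<integral>\<^sup>+u\<in>{0..s}.
            ennreal (B * ((s - u) powr \<gamma> / s) / (s - u) powr (1 + \<beta>)) \<partial>lborel) \<partial>lborel)"
  proof (rule nn_integral_mono)
    fix s :: real
    have "(\<integral>\<^sup>+\<omega>. ?f \<omega> s u \<partial>M)
        \<le> ennreal (B * ((s - u) powr \<gamma> / s) / (s - u) powr (1 + \<beta>)) * indicator {0..s} u"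
      if "s \<le> T" for u
    proof (cases "0 \<le> u \<and> u < s")
      case True
      let ?k = "ennreal (1 / (s - u) powr (1 + \<beta>))"
      have "(\<integral>\<^sup>+\<omega>. ?f \<omega> s u \<partial>M) = (\<integral>\<^sup>+\<omega>. ennreal \<bar>Y u \<omega> - Y s \<omega>\<bar> * ?k \<partial>M)"
        using True by (intro nn_integral_cong) (simp add: ennreal_mult[symmetric])
      also have "\<dots> = (\<integral>\<^sup>+\<omega>. ennreal \<bar>Y u \<omega> - Y s \<omega>\<bar> \<partial>M) * ?k"
        by (rule nn_integral_multc) measurable
      also have "\<dots> \<le> ennreal (B * ((s - u) powr \<gamma> / s)) * ?k"
        using incr[of u s] True that by (intro mult_right_mono) auto
      also have "\<dots> = ennreal (B * ((s - u) powr \<gamma> / s) / (s - u) powr (1 + \<beta>))"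
        using B True by (simp add: ennreal_mult[symmetric])
      finally show ?thesis using True by simp
    next
      \<comment> \<open>On the diagonal \<open>u = s\<close> both integrands have the value zero.\<close>
      case False
      then show ?thesis by (cases "u = s") (auto simp: indicator_def)
    qed
    then show "(\<integral>\<^sup>+u. (\<integral>\<^sup>+\<omega>. ?f \<omega> s u \<partial>M) \<partial>lborel) * indicator {0..T} s
      \<le> (\<integral>\<^sup>+u\<in>{0..s}. ennreal (B * ((s - u) powr \<gamma> / s) / (s - u) powr (1 + \<beta>)) \<partial>lborel)
          * indicator {0..T} s"
      by (auto simp: indicator_def[of "{0..T}"] intro!: nn_integral_mono)
  qed
  also have "\<dots> < \<infinity>" by (rule besov_kernel_finite[OF T B \<gamma>])
  finally have "(\<integral>\<^sup>+\<omega>. ?F \<omega> \<partial>M) \<noteq> \<infinity>" by simp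
  moreover have "?F \<in> borel_measurable M"
    by (unfold indicator_def atLeastAtMost_iff of_bool_def) measurable
  ultimately have "AE \<omega> in M. ?F \<omega> \<noteq> \<infinity>"
    by (intro nn_integral_PInf_AE)
  then show ?thesis by eventually_elim (simp add: less_top)
qed

theorem theorem3p1:
  fixes M :: "'a measure" and X :: "real \<Rightarrow> 'a \<Rightarrow> real"
    and T \<alpha> \<beta> :: real
  assumes "prob_space M"
    and "T > 0"
    and "0 < \<alpha>" and "\<alpha> < 1"
    and "class_X M T \<alpha> X"
    and "\<alpha> > 1 / 3"
    and "0 < \<beta>" and "\<beta> < min \<alpha> (3 * \<alpha> - 1)"
  shows "\<forall>f :: real \<Rightarrow> real. convex_on UNIV f \<longrightarrow>
           (AE \<omega> in M. (\<lambda>t. left_deriv f (X t \<omega>)) \<in> besov_space T \<beta>)"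
proof (intro allI impI)
  fix f :: "real \<Rightarrow> real" assume f: "convex_on UNIV f"
  interpret prob_space M by fact
  note T = \<open>T > 0\<close>
  have \<beta>: "\<beta> < \<alpha>" "\<beta> < 1" using assms by auto
  define g where "g = left_deriv f"
  have mono: "mono g" unfolding g_def by (rule mono_left_deriv[OF f])
  have g[measurable]: "g \<in> borel_measurable borel" by (rule borel_measurable_mono[OF mono])
  have G: "centered_gaussian_process M T X"
    and cont: "AE \<omega> in M. continuous_on {0..T} (\<lambda>t. X t \<omega>)"
    using assms(5) by (auto simp: class_X_def)
  have meas: "X t \<in> borel_measurable M" if "t \<in> {0..T}" for t
    using gaussian_process_rv[OF G that] by (simp add: centered_gaussian_rv_def)
  obtain Z where Zmeas: "\<And>t. Z t \<in> borel_measurable M"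
    and Zcont: "\<And>\<omega>. continuous_on UNIV (\<lambda>t. Z t \<omega>)"
    and Zbd: "\<And>\<omega>. bounded (range (\<lambda>t. Z t \<omega>))"
    and ZX: "AE \<omega> in M. \<forall>t\<in>{0..T}. Z t \<omega> = X t \<omega>"
    using continuous_modification[OF less_imp_le[OF T] meas cont] by blast
  have Zjoint[measurable]: "(\<lambda>(t, \<omega>). Z t \<omega>) \<in> borel_measurable (borel \<Otimes>\<^sub>M M)"
    by (rule measurable_split_continuous_process[OF Zmeas Zcont])
  define \<gamma> where "\<gamma> = (\<alpha> + \<beta>) / 2"
  have \<gamma>: "\<beta> < \<gamma>" "0 < \<gamma>" "\<gamma> < \<alpha>" using assms(7) \<beta>(1) by (auto simp: \<gamma>_def)
  obtain B where B: "0 \<le> B" "\<And>u s c. 0 \<le> u \<Longrightarrow> u < s \<Longrightarrow> s \<le> T \<Longrightarrow>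
    prob {\<omega>\<in>space M. \<bar>X s \<omega> - c\<bar> \<le> \<bar>X s \<omega> - X u \<omega>\<bar>} \<le> B * ((s - u) powr \<gamma> / s)"
    using class_X_straddle[OF T \<open>0 < \<alpha>\<close> assms(5) \<gamma>(2,3)] by blast
  \<comment> \<open>Truncating the argument, not the value, keeps \<open>g\<close> unchanged on every path bounded by \<open>n\<close>.\<close>
  define tr where "tr n x = g (max (- real n) (min (real n) x))" for n x
  have tr_mono: "mono (tr n)" for n
    unfolding tr_def by (intro monoI monoD[OF mono]) (auto simp: min_def max_def)
  have tr_bounds: "g (- real n) \<le> tr n x" "tr n x \<le> g (real n)" for n x
    unfolding tr_def by (auto intro!: monoD[OF mono])
  have [measurable]: "tr n \<in> borel_measurable borel" for n
    by (rule borel_measurable_mono[OF tr_mono])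
  have "AE \<omega> in M. (\<integral>\<^sup>+s\<in>{0..T}. (\<integral>\<^sup>+u\<in>{0..s}.
      ennreal (\<bar>tr n (Z u \<omega>) - tr n (Z s \<omega>)\<bar> / (s - u) powr (1 + \<beta>)) \<partial>lborel) \<partial>lborel) < \<infinity>" for n
  proof (rule AE_besov_seminorm_finite[where \<gamma>=\<gamma> and B="(g (real n) - g (- real n)) * B"])
    show "(\<lambda>(t, \<omega>). tr n (Z t \<omega>)) \<in> borel_measurable (borel \<Otimes>\<^sub>M M)" by measurable
    have "g (- real n) \<le> g (real n)" by (rule monoD[OF mono]) simp
    then show "0 \<le> (g (real n) - g (- real n)) * B" using B(1) by simp
    fix u s :: real assume us: "0 \<le> u" "u < s" "s \<le> T"
    have "(\<integral>\<^sup>+\<omega>. ennreal \<bar>tr n (Z u \<omega>) - tr n (Z s \<omega>)\<bar> \<partial>M)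
        = (\<integral>\<^sup>+\<omega>. ennreal \<bar>tr n (X u \<omega>) - tr n (X s \<omega>)\<bar> \<partial>M)"
      using ZX by (intro nn_integral_cong_AE, eventually_elim) (use us in auto)
    also have "\<dots> \<le> ennreal ((g (real n) - g (- real n)) * (B * ((s - u) powr \<gamma> / s)))"
      by (rule nn_integral_mono_diff_le[OF _ _ tr_mono tr_bounds])
         (use us meas B in auto)
    finally show "(\<integral>\<^sup>+\<omega>. ennreal \<bar>tr n (Z u \<omega>) - tr n (Z s \<omega>)\<bar> \<partial>M)
        \<le> ennreal ((g (real n) - g (- real n)) * B * ((s - u) powr \<gamma> / s))"
      by (simp add: mult.assoc)
  qed (use T \<gamma> in auto)
  then have "AE \<omega> in M. \<forall>n. (\<integral>\<^sup>+s\<in>{0..T}. (\<integral>\<^sup>+u\<in>{0..s}.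
      ennreal (\<bar>tr n (Z u \<omega>) - tr n (Z s \<omega>)\<bar> / (s - u) powr (1 + \<beta>)) \<partial>lborel) \<partial>lborel) < \<infinity>"
    by (simp add: AE_all_countable)
  with ZX show "AE \<omega> in M. (\<lambda>t. left_deriv f (X t \<omega>)) \<in> besov_space T \<beta>"
  proof eventually_elim
    case (elim \<omega>)
    let ?h = "\<lambda>t. g (Z t \<omega>)"
    have eq: "g (X t \<omega>) = ?h t" if "t \<in> {0..T}" for t using elim(1) that by simp
    have [measurable]: "(\<lambda>t. Z t \<omega>) \<in> borel_measurable borel"
      by (rule borel_measurable_continuous_onI[OF Zcont])
    obtain b where "\<And>t. \<bar>Z t \<omega>\<bar> \<le> b"
      using Zbd[of \<omega>] by (auto simp: bounded_iff)
    moreover obtain n where "b \<le> real n" using real_arch_simple by blast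
    ultimately have n: "\<bar>Z t \<omega>\<bar> \<le> real n" for t by (meson order_trans)
    \<comment> \<open>Along this path no truncation at or beyond \<open>n\<close> is visible.\<close>
    have h_tr: "?h t = tr n (Z t \<omega>)" for t
    proof -
      have "max (- real n) (min (real n) (Z t \<omega>)) = Z t \<omega>" using n[of t] by linarith
      then show ?thesis by (simp add: tr_def)
    qed
    define C where "C = max \<bar>g (real n)\<bar> \<bar>g (- real n)\<bar>"
    have C: "\<bar>?h t\<bar> \<le> C" for t using tr_bounds[of n "Z t \<omega>"] h_tr[of t] by (auto simp: C_def)
    have "(\<integral>\<^sup>+s\<in>{0..T}. ennreal (\<bar>?h s\<bar> / s powr \<beta>) \<partial>lborel)
        \<le> (\<integral>\<^sup>+s. ennreal C * (ennreal (s powr (- \<beta>)) * indicator {0..T} s) \<partial>lborel)"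
    proof (rule nn_integral_mono)
      fix s :: real
      have "ennreal (\<bar>?h s\<bar> / s powr \<beta>) \<le> ennreal (C * s powr (- \<beta>))"
        using C[of s] by (intro ennreal_leI) (auto simp: powr_minus divide_inverse intro!: mult_right_mono)
      also have "\<dots> = ennreal C * ennreal (s powr (- \<beta>))"
        by (rule ennreal_mult) (auto simp: C_def)
      finally show "ennreal (\<bar>?h s\<bar> / s powr \<beta>) * indicator {0..T} s
          \<le> ennreal C * (ennreal (s powr (- \<beta>)) * indicator {0..T} s)"
        by (auto simp: indicator_def)
    qed
    also have "\<dots> = ennreal C * ennreal (T powr (- \<beta> + 1) / (- \<beta> + 1))"
      using nn_integral_powr_from_0[of "- \<beta>" T] \<beta>(2) T by (subst nn_integral_cmult) auto
    also have "\<dots> < \<infinity>" by (simp add: ennreal_mult_less_top)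
    finally have fst: "(\<integral>\<^sup>+s\<in>{0..T}. ennreal (\<bar>?h s\<bar> / s powr \<beta>) \<partial>lborel) < \<infinity>" .
    have "besov_norm T \<beta> (\<lambda>t. g (X t \<omega>)) = besov_norm T \<beta> ?h"
      unfolding besov_norm_def
      by (intro arg_cong2[where f="(+)"] nn_integral_cong)
         (auto simp: indicator_def eq intro!: nn_integral_cong)
    also have "\<dots> < \<infinity>"
      using fst elim(2)[rule_format, of n] by (simp add: besov_norm_def h_tr)
    finally have "besov_norm T \<beta> (\<lambda>t. g (X t \<omega>)) < \<infinity>" .
    moreover have "(\<lambda>t. g (X t \<omega>)) \<in> borel_measurable (restrict_space borel {0..T})"
    proof (subst measurable_cong)
      show "?h \<in> borel_measurable (restrict_space borel {0..T})"
        by (intro measurable_restrict_space1) measurable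
    qed (auto simp: eq space_restrict_space)
    ultimately show ?case by (simp add: besov_space_def g_def)
  qed
qed

end
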